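(* For every $n\in\mathbb{N}$ and every real $\alpha>\frac{\log 2}{\log(1+\sqrt{2})}$ (which is approximately $0.7865$), there exist $k\ge n$ and a subdivision $G$ of the $k$-ladder such that $|\Lambda(G)|\le k^{\alpha}$.
   Context: The $k$-ladder is the Cartesian product of $K_2$ and a path on $k$ vertices. A subdivision of a graph $H$ is a graph obtained from $H$ by replacing each edge by a path of length at least $1$ with the same ends, these paths being internally disjoint from each other and from $V(H)$. The cycle spectrum of a graph $G$ is $\Lambda(G)=\{\ell\in\mathbb{N}\mid G\text{ contains a cycle of length }\ell\}$. *)

theory Defs
  imports Complex_Main "Graph_Theory.Graph_Theory"
begin

text \<open>Finite simple graphs are the symmetric loop-free digraphs of Graph_Theory
  (locale \<^locale>\<open>pair_graph\<close>): an undirected edge is a pair of opposite arcs.\<close>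

definition complete_graph_2 :: "nat pair_pre_digraph" where
  "complete_graph_2 = \<lparr> pverts = {0, 1}, parcs = {(0, 1), (1, 0)} \<rparr>"

definition path_graph :: "nat \<Rightarrow> nat pair_pre_digraph" where
  "path_graph k = \<lparr> pverts = {0..<k},
     parcs = {(i, j). i < k \<and> j < k \<and> (j = Suc i \<or> i = Suc j)} \<rparr>"

definition cartesian_product ::
  "'a pair_pre_digraph \<Rightarrow> 'b pair_pre_digraph \<Rightarrow> ('a \<times> 'b) pair_pre_digraph" where
  "cartesian_product G H = \<lparr> pverts = pverts G \<times> pverts H,
     parcs = {((a, b), (c, d)).
       (a = c \<and> a \<in> pverts G \<and> (b, d) \<in> parcs H) \<or>
       (b = d \<and> b \<in> pverts H \<and> (a, c) \<in> parcs G)} \<rparr>"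

definition ladder :: "nat \<Rightarrow> (nat \<times> nat) pair_pre_digraph" where
  "ladder k = cartesian_product complete_graph_2 (path_graph k)"

definition interior_verts :: "'a list \<Rightarrow> 'a set" where
  "interior_verts p = set (butlast (tl p))"

text \<open>\<open>P u v\<close> is the path replacing the edge \<open>uv\<close>, as a vertex list from \<open>u\<close> to \<open>v\<close>;
  the opposite arc gets the reversed list, so that each undirected edge is replaced by one
  path. As usual, the vertices of \<open>H\<close> are themselves vertices of the subdivision \<open>G\<close>.\<close>

definition subdivision_of :: "'a pair_pre_digraph \<Rightarrow> 'a pair_pre_digraph \<Rightarrow> bool" where
  "subdivision_of G H \<longleftrightarrow> pair_graph G \<and> (\<exists>P :: 'a \<Rightarrow> 'a \<Rightarrow> 'a list.
     (\<forall>(u, v) \<in> parcs H.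
        vpath (P u v) (with_proj G) \<and> vwalk_length (P u v) \<ge> 1 \<and>
        hd (P u v) = u \<and> last (P u v) = v \<and>
        P v u = rev (P u v) \<and>
        interior_verts (P u v) \<inter> pverts H = {}) \<and>
     (\<forall>(u, v) \<in> parcs H. \<forall>(x, y) \<in> parcs H. {u, v} \<noteq> {x, y} \<longrightarrow>
        interior_verts (P u v) \<inter> interior_verts (P x y) = {}) \<and>
     pverts G = pverts H \<union> (\<Union>(u, v) \<in> parcs H. set (P u v)) \<and>
     parcs G = (\<Union>(u, v) \<in> parcs H. set (vwalk_arcs (P u v))))"

text \<open>The library's \<^const>\<open>pre_digraph.cycle\<close> also admits the closed walk of length 2 that
  traverses an edge back and forth, which is not a cycle of the undirected graph.\<close>

definition cycle_spectrum :: "'a pair_pre_digraph \<Rightarrow> nat set" where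
  "cycle_spectrum G = {l. \<exists>p. pre_digraph.cycle (with_proj G) p \<and> length p = l \<and> 3 \<le> l}"

lemma pair_graph_ladder: "pair_graph (ladder k)"
proof -
  have 1: "finite (pverts (ladder k))"
    by (simp add: ladder_def cartesian_product_def complete_graph_2_def path_graph_def)
  have 2: "parcs (ladder k) \<subseteq> pverts (ladder k) \<times> pverts (ladder k)"
    by (auto simp: ladder_def cartesian_product_def complete_graph_2_def path_graph_def)
  have 3: "finite (parcs (ladder k))"
    using 1 2 by (meson finite_SigmaI finite_subset)
  have 4: "sym (parcs (ladder k))"
    by (auto simp: sym_def ladder_def cartesian_product_def complete_graph_2_def path_graph_def)
  have 5: "fst e \<noteq> snd e" if "e \<in> parcs (ladder k)" for e
    using that by (auto simp: ladder_def cartesian_product_def complete_graph_2_def path_graph_def)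
  show ?thesis
    using 1 2 3 4 5 by unfold_locales (auto simp: symmetric_def)
qed

lemma finite_cycle_spectrum:
  assumes "pair_graph G"
  shows "finite (cycle_spectrum G)"
proof -
  interpret pair_graph G by fact
  have "l \<le> card (pverts G)" if "l \<in> cycle_spectrum G" for l
  proof -
    from that obtain p where p: "cycle p" "length p = l"
      by (auto simp: cycle_spectrum_def)
    then obtain u where u: "awalk u p u" "distinct (tl (pawalk_verts u p))"
      by (auto simp: cycle_def)
    have "length (pawalk_verts u p) = Suc (length p)"
      by (induct p arbitrary: u) auto
    then have "l = card (set (tl (pawalk_verts u p)))"
      using u p by (simp add: distinct_card)
    also have "\<dots> \<le> card (pverts G)"
    proof (rule card_mono)
      show "set (tl (pawalk_verts u p)) \<subseteq> pverts G"
      proof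
        fix v
        assume "v \<in> set (tl (pawalk_verts u p))"
        then have "v \<in> set (pawalk_verts u p)"
          by (cases "pawalk_verts u p") auto
        then show "v \<in> pverts G"
          using awalk_verts_in_verts u(1) by (auto simp: awalk_def)
      qed
    qed (rule pair_finite_verts)
    finally show ?thesis .
  qed
  then show ?thesis
    by (meson finite_nat_set_iff_bounded_le)
qed

lemma subdivision_of_refl:
  assumes "pair_graph H"
  shows "subdivision_of H H"
proof -
  interpret pair_graph H by fact
  show ?thesis
    unfolding subdivision_of_def
  proof (intro conjI exI[of _ "\<lambda>u v. [u, v]"] assms)
    show "\<forall>(u, v)\<in>parcs H. vpath [u, v] (with_proj H) \<and> 1 \<le> vwalk_length [u, v] \<and>
        hd [u, v] = u \<and> last [u, v] = v \<and> [v, u] = rev [u, v] \<and>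
        interior_verts [u, v] \<inter> pverts H = {}"
    proof (intro ballI, clarify)
      fix u v
      assume uv: "(u, v) \<in> parcs H"
      then have "u \<noteq> v" "u \<in> pverts H" "v \<in> pverts H"
        using pair_no_loops[OF uv] in_arcsD1[OF uv] in_arcsD2[OF uv] by auto
      with uv show "vpath [u, v] (with_proj H) \<and> 1 \<le> vwalk_length [u, v] \<and>
          hd [u, v] = u \<and> last [u, v] = v \<and> [v, u] = rev [u, v] \<and>
          interior_verts [u, v] \<inter> pverts H = {}"
        by (simp add: vpath_def vwalk_def interior_verts_def)
    qed
  qed (auto simp: interior_verts_def dest: in_arcsD1 in_arcsD2)
qed

end

theory Submission
  imports Defs "HOL-Library.Infinite_Set" "HOL-Real_Asymp.Real_Asymp"
begin

text \<open>A cycle of a subdivided ladder is determined by its extreme rungs \<open>i < j\<close>. If the rungs have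
  lengths \<open>r\<^sub>i\<close> and sit at positions \<open>s\<^sub>i\<close> of the rails, its length is \<open>r\<^sub>i + r\<^sub>j + 2 (s\<^sub>j - s\<^sub>i)\<close>. For
  \<open>s\<^sub>i = x\<^sub>i - y\<^sub>i + K\<close> and \<open>r\<^sub>i = 2 (x\<^sub>i + y\<^sub>i) + 1\<close> this equals \<open>4 (x\<^sub>j + y\<^sub>i) + 2\<close>. So it suffices to find
  many pairs with distinct differences \<open>x\<^sub>i - y\<^sub>i\<close> but few sums \<open>x\<^sub>j + y\<^sub>i\<close>, in the spirit of Hennecart,
  Freiman and Yudin.

  Take integer vectors \<open>z\<close> of dimension \<open>d\<close> with entries in \<open>[-M, M]\<close> whose positive part \<open>z\<^sup>+\<close> has
  entry sum \<open>p\<close> and whose negative part \<open>z\<^sup>-\<close> has entry sum \<open>q\<close>, and let \<open>x, y\<close> be \<open>z\<^sup>+, z\<^sup>-\<close> read in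
  base \<open>2 M + 1\<close>. There are at most \<open>2 ^ (p + q + d)\<close> sums. Weighting \<open>z\<close> by \<open>t ^ (p + q)\<close> with
  \<open>t = sqrt 2 - 1\<close>, all vectors together have weight \<open>g ^ d\<close>, where \<open>g\<close> tends to
  \<open>(1 + t) / (1 - t) = 1 + sqrt 2 = 1 / t\<close> as \<open>M\<close> grows. Hence for suitable \<open>p, q\<close> the number of vectors
  is about \<open>(1 + sqrt 2) ^ (p + q + d)\<close>.\<close>

section \<open>Many differences and few sums\<close>


text \<open>Expanding the power by distributivity gives one product per list. This evaluates the
  total weight of all vectors as \<open>g M ^ d\<close>.\<close>

lemma sum_prod_list_lists:
  fixes f :: "'a \<Rightarrow> 'b::comm_semiring_1"
  assumes "finite A"
  shows "(\<Sum>xs | set xs \<subseteq> A \<and> length xs = n. prod_list (map f xs)) = sum f A ^ n"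
proof (induction n)
  case 0
  have "{xs. set xs \<subseteq> A \<and> length xs = 0} = {[]}" by auto
  then show ?case by simp
next
  case (Suc n)
  let ?L = "{xs. set xs \<subseteq> A \<and> length xs = n}"
  have "(\<Sum>xs | set xs \<subseteq> A \<and> length xs = Suc n. prod_list (map f xs))
      = (\<Sum>(xs, a)\<in>?L \<times> A. f a * prod_list (map f xs))"
    unfolding lists_length_Suc_eq
    by (subst sum.reindex) (auto simp: inj_on_def intro!: sum.cong)
  also have "\<dots> = (\<Sum>xs\<in>?L. \<Sum>a\<in>A. f a * prod_list (map f xs))"
    by (rule sum.cartesian_product[symmetric])
  also have "\<dots> = sum f A ^ Suc n"
    by (simp add: Suc.IH[symmetric] sum_distrib_right[symmetric] sum_distrib_left)
  finally show ?case .
qed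

text \<open>Weighted pigeonhole: fibres all below average could not add up to
  \<open>sum w Z\<close>.\<close>

lemma heavy_fibre:
  fixes w :: "'a \<Rightarrow> real"
  assumes "finite Z" "finite C" "C \<noteq> {}" "f ` Z \<subseteq> C"
  obtains c where "c \<in> C" "sum w Z \<le> card C * sum w {z\<in>Z. f z = c}"
proof (rule ccontr)
  assume "\<not> thesis"
  then have "card C * sum w {z\<in>Z. f z = c} < sum w Z" if "c \<in> C" for c
    using that \<open>\<And>c. c \<in> C \<Longrightarrow> _ \<Longrightarrow> thesis\<close> by (meson not_le)
  then have "(\<Sum>c\<in>C. card C * sum w {z\<in>Z. f z = c}) < (\<Sum>c\<in>C. sum w Z)"
    by (intro sum_strict_mono assms) auto
  moreover have "(\<Sum>c\<in>C. sum w {z\<in>Z. f z = c}) = sum w Z"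
    by (rule sum.group[OF assms(1,2,4)])
  ultimately show False
    by (simp add: sum_distrib_left[symmetric])
qed

section \<open>Weights of integer vectors\<close>

lemma two_sided_geometric_sum:
  fixes t :: real
  assumes "t \<noteq> 1"
  shows "(\<Sum>v\<in>{-int M..int M}. t ^ nat \<bar>v\<bar>) = (1 + t - 2 * t ^ Suc M) / (1 - t)"
proof (induction M)
  case (Suc M)
  have "{-int (Suc M)..int (Suc M)} = insert (-int (Suc M)) (insert (int (Suc M)) {-int M..int M})"
    by auto
  then have "(\<Sum>v\<in>{-int (Suc M)..int (Suc M)}. t ^ nat \<bar>v\<bar>)
      = 2 * t ^ Suc M + (\<Sum>v\<in>{-int M..int M}. t ^ nat \<bar>v\<bar>)"
    by (simp add: nat_add_distrib)
  then show ?case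
    using assms Suc.IH by (simp add: field_simps)
qed (use assms in \<open>simp add: field_simps\<close>)

lemma two_sided_geometric_sum_tendsto:
  "(\<lambda>M. \<Sum>v\<in>{-int M..int M}. (sqrt 2 - 1) ^ nat \<bar>v\<bar>) \<longlonglongrightarrow> 1 + sqrt 2"
proof -
  have s: "1 < sqrt 2" "sqrt 2 < 2" "sqrt 2 * sqrt 2 = 2"
    by (simp_all add: real_less_lsqrt)
  have "(\<lambda>M. (sqrt 2 - 1) ^ Suc M) \<longlonglongrightarrow> 0"
    using s by (intro LIMSEQ_Suc LIMSEQ_realpow_zero) auto
  then have "(\<lambda>M. (1 + (sqrt 2 - 1) - 2 * (sqrt 2 - 1) ^ Suc M) / (1 - (sqrt 2 - 1)))
      \<longlonglongrightarrow> (1 + (sqrt 2 - 1) - 2 * 0) / (1 - (sqrt 2 - 1))"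
    using s by (intro tendsto_intros) auto
  moreover have "(1 + (sqrt 2 - 1) - 2 * 0) / (1 - (sqrt 2 - 1)) = 1 + sqrt 2"
    using s by (simp add: field_simps)
  ultimately show ?thesis
    using s by (subst two_sided_geometric_sum) auto
qed

lemma prod_list_power_abs:
  fixes t :: real
  shows "prod_list (map (\<lambda>v. t ^ nat \<bar>v\<bar>) z)
    = t ^ (sum_list (map nat z) + sum_list (map (\<lambda>v. nat (-v)) z))"
proof (induction z)
  case (Cons v z)
  have "nat \<bar>v\<bar> = nat v + nat (-v)" by simp
  then show ?case using Cons by (simp add: power_add mult_ac)
qed simp

lemma sum_list_nat_le:
  assumes "set z \<subseteq> {-int M..int M}"
  shows "sum_list (map nat z) \<le> M * length z" "sum_list (map (\<lambda>v. nat (-v)) z) \<le> M * length z"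
  using assms by (induction z) auto

section \<open>Evaluation in base \<open>2 M + 1\<close>\<close>

text \<open>The digits from \<open>-M\<close> to \<open>M\<close> represent each residue modulo
  \<open>2 M + 1\<close> once, so the value determines the first entry, and induction does the
  rest.\<close>

lemma horner_sum_inj:
  fixes xs ys :: "int list"
  assumes "length xs = length ys" "set xs \<subseteq> {-int M..int M}" "set ys \<subseteq> {-int M..int M}"
    and "horner_sum (\<lambda>v. v) (2 * int M + 1) xs = horner_sum (\<lambda>v. v) (2 * int M + 1) ys"
  shows "xs = ys"
  using assms
proof (induction xs ys rule: list_induct2)
  case (Cons a xs b ys)
  let ?B = "2 * int M + 1"
  have eq: "a - b = ?B * (horner_sum (\<lambda>v. v) ?B ys - horner_sum (\<lambda>v. v) ?B xs)"
    using Cons.prems(3) by (simp add: algebra_simps)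
  moreover have "\<bar>a - b\<bar> < ?B"
    using Cons.prems by auto
  ultimately have "a - b = 0"
    using dvd_imp_le_int[of "a - b" ?B] by fastforce
  then show ?case
    using eq Cons by auto
qed simp

text \<open>Splitting \<open>v = nat v - nat (-v)\<close> entrywise makes \<open>x z - y z\<close>
  the value of \<open>z\<close> itself, to which \<open>horner_sum_inj\<close> applies.\<close>

lemma horner_sum_nat_diff:
  "int (horner_sum nat B z) - int (horner_sum (\<lambda>v. nat (-v)) B z) = horner_sum (\<lambda>v. v) (int B) z"
proof (induction z)
  case (Cons v z)
  have "int B * (int (horner_sum nat B z) - int (horner_sum (\<lambda>v. nat (-v)) B z))
      = int B * horner_sum (\<lambda>v. v) (int B) z"
    using Cons by simp
  then show ?case by (simp add: right_diff_distrib)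
qed simp

text \<open>Used to show that \<open>x z + y z'\<close> depends only on the list of entrywise sums,
  whatever carries occur; counting such lists bounds the number of sums.\<close>

lemma horner_sum_add_map2:
  fixes B :: nat
  assumes "length xs = length ys"
  shows "horner_sum f B xs + horner_sum g B ys = horner_sum (\<lambda>v. v) B (map2 (\<lambda>a b. f a + g b) xs ys)"
  using assms
proof (induction xs ys rule: list_induct2)
  case (Cons a xs b ys)
  then show ?case by (simp flip: Cons.IH add: distrib_left)
qed simp

lemma sum_list_map2_add:
  fixes f g :: "'a \<Rightarrow> nat"
  assumes "length xs = length ys"
  shows "sum_list (map2 (\<lambda>a b. f a + g b) xs ys) = sum_list (map f xs) + sum_list (map g ys)"
  using assms by (induction xs ys rule: list_induct2) auto

text \<open>Stars and bars, with the binomial coefficient bounded by a power of two.\<close>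

lemma card_nat_lists_le:
  "card {l :: nat list. length l = m \<and> sum_list l = N} \<le> 2 ^ (N + m)"
proof -
  have "(N + m - 1) choose N \<le> 2 ^ (N + m - 1)"
    by (rule binomial_le_pow2)
  also have "\<dots> \<le> 2 ^ (N + m)"
    by (intro power_increasing) auto
  finally show ?thesis by (simp add: card_length_sum_list)
qed

lemma finite_nat_lists: "finite {l :: nat list. length l = m \<and> sum_list l = N}"
proof (rule finite_subset)
  show "{l :: nat list. length l = m \<and> sum_list l = N} \<subseteq> {l. set l \<subseteq> {..N} \<and> length l = m}"
    using member_le_sum_list by force
qed (rule finite_lists_length_eq, simp)

text \<open>Up to a factor polynomial in \<open>d\<close>, the heavy fibre has at least
  \<open>g M ^ d * c ^ (p + q)\<close> elements. Raised to \<alpha>, each of these factors exceeds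
  2, and the excess of \<open>g M powr \<alpha>\<close> over 2 absorbs the polynomial.\<close>

lemma many_differences_few_sums:
  fixes n :: nat and \<alpha> :: real
  assumes "\<alpha> > ln 2 / ln (1 + sqrt 2)"
  obtains Z :: "int list set" and x y :: "int list \<Rightarrow> nat"
  where "finite Z" "n \<le> card Z" "inj_on (\<lambda>z. int (x z) - int (y z)) Z"
    "card {x z + y z' |z z'. z \<in> Z \<and> z' \<in> Z} \<le> real (card Z) powr \<alpha>"
    "finite {x z + y z' |z z'. z \<in> Z \<and> z' \<in> Z}"
proof -
  define c where "c = 1 + sqrt 2"
  \<comment> \<open>\<open>t\<close> is the positive root of
    \<open>(1 + t) / (1 - t) = 1 / t\<close>, so in the limit a coordinate and a unit of entry sum
    contribute the same factor \<open>c\<close>.\<close>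
  define t where "t = sqrt 2 - 1"
  have c: "1 < c" "c * t = 1" "0 < t" by (simp_all add: c_def t_def algebra_simps)
  then have "0 < ln c" by simp
  then have "0 < ln 2 / ln c" by simp
  with assms have \<alpha>: "0 < \<alpha>" unfolding c_def by linarith
  \<comment> \<open>The bound on \<alpha> amounts to \<open>2 < c powr \<alpha>\<close>.\<close>
  have "ln 2 < \<alpha> * ln c"
    using assms \<open>0 < ln c\<close> by (simp add: c_def pos_divide_less_eq)
  then have c\<alpha>: "2 < c powr \<alpha>"
    using c by (simp add: powr_def flip: ln_less_cancel_iff)
  have pow: "(b ^ m) powr \<alpha> = (b powr \<alpha>) ^ m" if "0 < b" for b m
    using that by (simp add: powr_powr mult.commute flip: powr_realpow)
  define g where "g M = (\<Sum>v\<in>{-int M..int M}. t ^ nat \<bar>v\<bar>)" for M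
  have "(\<lambda>M. g M powr \<alpha>) \<longlonglongrightarrow> c powr \<alpha>"
    using two_sided_geometric_sum_tendsto c unfolding g_def t_def c_def
    by (intro tendsto_powr) auto
  then have "eventually (\<lambda>M. 2 < g M powr \<alpha>) sequentially"
    using c\<alpha> by (rule order_tendstoD)
  then obtain M where M: "2 < g M powr \<alpha>"
    by (auto simp: eventually_sequentially)
  have g0: "0 < g M"
    unfolding g_def using c by (intro sum_pos) auto
  \<comment> \<open>\<open>h\<close> is the surplus per coordinate; \<open>h ^ d\<close> outgrows
    the polynomial loss from fixing \<open>p\<close> and \<open>q\<close>.\<close>
  define h where "h = g M powr \<alpha> / 2"
  have h: "1 < h" using M by (simp add: h_def)
  have "eventually (\<lambda>d. (real M * real d + 1) powr (2 * \<alpha>) \<le> h ^ d) sequentially"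
  proof (cases "M = 0")
    case True
    then show ?thesis using h by simp
  next
    case False
    then have "0 < real M" by simp
    with h \<alpha> show ?thesis by real_asymp
  qed
  \<comment> \<open>This will force \<open>n \<le> card Z\<close>, as
    \<open>card Z powr \<alpha>\<close> turns out to be at least \<open>2 ^ d\<close>.\<close>
  moreover have "eventually (\<lambda>d. real n powr \<alpha> < 2 ^ d) sequentially"
    by real_asymp
  ultimately have "eventually (\<lambda>d. (real M * real d + 1) powr (2 * \<alpha>) \<le> h ^ d
      \<and> real n powr \<alpha> < 2 ^ d) sequentially"
    by (rule eventually_conj)
  then obtain d where d: "(real M * real d + 1) powr (2 * \<alpha>) \<le> h ^ d" "real n powr \<alpha> < 2 ^ d"
    by (auto simp: eventually_sequentially)

  define L where "L = {z. set z \<subseteq> {-int M..int M} \<and> length z = d}"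
  define P where "P z = sum_list (map nat z)" for z
  define Q where "Q z = sum_list (map (\<lambda>v. nat (-v)) z)" for z
  have finL: "finite L" unfolding L_def by (rule finite_lists_length_eq) simp
  \<comment> \<open>Fixing \<open>p\<close> and \<open>q\<close> loses only a polynomial factor, and it fixes the entry sum \<open>p + q\<close> of
    every vector \<open>z\<^sup>+ + z'\<^sup>-\<close>, so that there are at most \<open>2 ^ (p + q + d)\<close> of these.\<close>
  obtain p q where "(\<Sum>z\<in>L. t ^ (P z + Q z))
      \<le> card ({..M * d} \<times> {..M * d}) * (\<Sum>z\<in>{z\<in>L. (P z, Q z) = (p, q)}. t ^ (P z + Q z))"
  proof (rule heavy_fibre[of L "{..M * d} \<times> {..M * d}" "\<lambda>z. (P z, Q z)" "\<lambda>z. t ^ (P z + Q z)"])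
    show "(\<lambda>z. (P z, Q z)) ` L \<subseteq> {..M * d} \<times> {..M * d}"
      using sum_list_nat_le by (auto simp: L_def P_def Q_def)
  qed (use finL in auto)
  moreover have "(\<Sum>z\<in>L. t ^ (P z + Q z)) = g M ^ d"
    unfolding L_def g_def P_def Q_def
    using sum_prod_list_lists[of "{-int M..int M}" "\<lambda>v. t ^ nat \<bar>v\<bar>" d]
    by (simp add: prod_list_power_abs)
  moreover define Z where "Z = {z\<in>L. P z = p \<and> Q z = q}"
  ultimately have "g M ^ d \<le> (real M * real d + 1)\<^sup>2 * (card Z * t ^ (p + q))"
    by (simp add: card_cartesian_product power2_eq_square algebra_simps)
  \<comment> \<open>Since \<open>c * t = 1\<close>, this cancels the weight shared by all vectors in
    \<open>Z\<close>.\<close>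
  then have "g M ^ d * c ^ (p + q) \<le> (real M * real d + 1)\<^sup>2 * (card Z * t ^ (p + q)) * c ^ (p + q)"
    using c by (intro mult_right_mono) auto
  also have "\<dots> = (real M * real d + 1)\<^sup>2 * card Z"
    using c by (simp add: mult_ac flip: power_mult_distrib)
  finally have "(g M ^ d * c ^ (p + q)) powr \<alpha> \<le> ((real M * real d + 1)\<^sup>2 * card Z) powr \<alpha>"
    using \<alpha> g0 c by (intro powr_mono2) auto
  also have "\<dots> = (real M * real d + 1) powr (2 * \<alpha>) * card Z powr \<alpha>"
    by (simp add: powr_mult powr_powr flip: powr_numeral)
  also have "\<dots> \<le> h ^ d * card Z powr \<alpha>"
    using d by (intro mult_right_mono) auto
  finally have "(g M powr \<alpha>) ^ d * (c powr \<alpha>) ^ (p + q) \<le> h ^ d * card Z powr \<alpha>"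
    using g0 c by (simp add: powr_mult pow)
  moreover have "(g M powr \<alpha>) ^ d * 2 ^ (p + q) \<le> (g M powr \<alpha>) ^ d * (c powr \<alpha>) ^ (p + q)"
    using c\<alpha> by (intro mult_left_mono power_mono) auto
  moreover have "(g M powr \<alpha>) ^ d = h ^ d * 2 ^ d"
    by (simp add: h_def flip: power_mult_distrib)
  ultimately have "h ^ d * (2 ^ d * 2 ^ (p + q)) \<le> h ^ d * card Z powr \<alpha>"
    by (simp add: mult_ac)
  then have Z: "2 ^ d * 2 ^ (p + q) \<le> card Z powr \<alpha>"
    using h by simp
  define B where "B = 2 * M + 1"
  show ?thesis
  proof (rule that[of Z "horner_sum nat B" "horner_sum (\<lambda>v. nat (-v)) B"])
    show "finite Z" using finL by (simp add: Z_def)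
    show "n \<le> card Z"
    proof (rule ccontr)
      assume "\<not> n \<le> card Z"
      then have "card Z powr \<alpha> \<le> real n powr \<alpha>" using \<alpha> by (intro powr_mono2) auto
      moreover have "(2::real) ^ d * 1 \<le> 2 ^ d * 2 ^ (p + q)" by (intro mult_left_mono) auto
      ultimately show False using Z d by linarith
    qed
    show "inj_on (\<lambda>z. int (horner_sum nat B z) - int (horner_sum (\<lambda>v. nat (- v)) B z)) Z"
      unfolding horner_sum_nat_diff
      by (rule inj_onI) (auto simp: Z_def L_def B_def add.commute intro!: horner_sum_inj[of _ _ M])
    let ?S = "{horner_sum nat B z + horner_sum (\<lambda>v. nat (-v)) B z' |z z'. z \<in> Z \<and> z' \<in> Z}"
    let ?N = "{l :: nat list. length l = d \<and> sum_list l = p + q}"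
    have sub: "?S \<subseteq> horner_sum (\<lambda>v. v) B ` ?N"
    proof (intro subsetI, clarify)
      fix z z' assume "z \<in> Z" "z' \<in> Z"
      then show "horner_sum nat B z + horner_sum (\<lambda>v. nat (-v)) B z' \<in> horner_sum (\<lambda>v. v) B ` ?N"
        by (subst horner_sum_add_map2)
          (auto simp: Z_def L_def P_def Q_def sum_list_map2_add intro!: imageI)
    qed
    then show "finite ?S"
      by (rule finite_subset) (intro finite_imageI finite_nat_lists)
    have "card ?S \<le> card (horner_sum (\<lambda>v. v) B ` ?N)"
      by (intro card_mono sub finite_imageI finite_nat_lists)
    also have "\<dots> \<le> card ?N"
      by (intro card_image_le finite_nat_lists)
    also have "\<dots> \<le> 2 ^ (p + q + d)"
      by (rule card_nat_lists_le)
    finally have "real (card ?S) \<le> real (2 ^ (p + q + d))"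
      by (rule of_nat_mono)
    also have "\<dots> = 2 ^ d * 2 ^ (p + q)"
      by (simp add: power_add)
    finally show "card ?S \<le> card Z powr \<alpha>" using Z by linarith
  qed
qed

section \<open>Cycles in a subdivided ladder\<close>


lemma pcas_nth:
  assumes "pre_digraph.cas (with_proj G) u p v" "p \<noteq> []"
  shows "fst (p ! 0) = u \<and> snd (last p) = v \<and> (\<forall>i. Suc i < length p \<longrightarrow> fst (p ! Suc i) = snd (p ! i))"
  using assms
proof (induction p arbitrary: u)
  case (Cons e p)
  show ?case
  proof (cases "p = []")
    case True
    then show ?thesis using Cons.prems by (simp add: pre_digraph.cas.simps)
  next
    case False
    then have "fst (p ! 0) = snd e \<and> snd (last p) = v \<and>
        (\<forall>i. Suc i < length p \<longrightarrow> fst (p ! Suc i) = snd (p ! i))"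
      using Cons.IH[of "snd e"] Cons.prems by (simp add: pre_digraph.cas.simps)
    then show ?thesis
      using False Cons.prems by (auto simp: pre_digraph.cas.simps nth_Cons split: nat.split)
  qed
qed simp

lemma awalk_verts_conv_snd:
  assumes "pre_digraph.cas (with_proj G) u p v"
  shows "pre_digraph.awalk_verts (with_proj G) u p = u # map snd p"
  using assms
  by (induction p arbitrary: u) (auto simp: pre_digraph.cas.simps pre_digraph.awalk_verts.simps)

text \<open>Keeping only the symmetric relation \<open>U\<close> and the set \<open>V\<close>
  removes the starting point and direction of the cycle. Connectedness takes the form that a
  \<open>U\<close>-closed set meeting \<open>V\<close> contains \<open>V\<close>.\<close>

lemma cycle_spectrum_used_edges:
  assumes "l \<in> cycle_spectrum G"
  obtains U V where
    "finite V" "V \<noteq> {}" "card V = l"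
    "\<And>a b. U a b \<Longrightarrow> U b a"
    "\<And>a b. U a b \<Longrightarrow> (a, b) \<in> parcs G \<or> (b, a) \<in> parcs G"
    "\<And>a. a \<in> V \<Longrightarrow> \<exists>b c. b \<noteq> c \<and> {w. U a w} = {b, c}"
    "\<And>a b. U a b \<Longrightarrow> a \<in> V"
    "\<And>X a. \<lbrakk>a \<in> X; a \<in> V; \<And>x y. \<lbrakk>x \<in> X; U x y\<rbrakk> \<Longrightarrow> y \<in> X\<rbrakk> \<Longrightarrow> V \<subseteq> X"
proof -
  obtain p u where p: "length p = l" "3 \<le> l" "set p \<subseteq> parcs G"
    "pre_digraph.cas (with_proj G) u p u"
    "distinct (tl (pre_digraph.awalk_verts (with_proj G) u p))"
    using assms by (auto simp: cycle_spectrum_def pre_digraph.cycle_def pre_digraph.awalk_def)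
  \<comment> \<open>The heads of the arcs list each vertex once: the start \<open>u\<close>
    reappears as the last head.\<close>
  define xs where "xs = map snd p"
  have len: "length xs = l" and dist: "distinct xs"
    using p(1,5) awalk_verts_conv_snd[OF p(4)] by (auto simp: xs_def)
  \<comment> \<open>Cyclic successor and predecessor of an index; they differ because
    \<open>3 \<le> l\<close>.\<close>
  define nx where "nx i = (if Suc i = l then 0 else Suc i)" for i
  define pv where "pv i = (if i = 0 then l - 1 else i - 1)" for i
  have nx: "nx i < l" and pv: "pv i < l" and nxpv: "nx (pv i) = i" and pvnx: "pv (nx i) = i"
    and ne: "nx i \<noteq> pv i" if "i < l" for i
    using that p by (auto simp: nx_def pv_def)
  have arc: "(xs ! i, xs ! nx i) \<in> parcs G" if "i < l" for i
  proof -
    have "p \<noteq> []" using p by auto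
    with pcas_nth[OF p(4)] have *: "fst (p ! 0) = u" "snd (last p) = u"
      "\<And>i. Suc i < length p \<Longrightarrow> fst (p ! Suc i) = snd (p ! i)" by auto
    have "fst (p ! nx i) = snd (p ! i)"
    proof (cases "Suc i = l")
      case True
      then have "i = length p - 1" using p by simp
      then have "p ! i = last p" using \<open>p \<noteq> []\<close> by (simp add: last_conv_nth)
      then show ?thesis using * True by (simp add: nx_def)
    next
      case False
      then show ?thesis using * that p by (simp add: nx_def)
    qed
    moreover have "p ! nx i \<in> parcs G" using p nx[OF that] by (metis nth_mem subsetD)
    ultimately show ?thesis
      using that nx[OF that] p by (metis nth_map prod.collapse xs_def)
  qed
  define U where "U a b \<longleftrightarrow> (\<exists>i<l. (a = xs ! i \<and> b = xs ! nx i) \<or> (b = xs ! i \<and> a = xs ! nx i))" for a b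
  show ?thesis
  proof (rule that[of "set xs" U])
    show "finite (set xs)" "set xs \<noteq> {}" "card (set xs) = l"
      using len dist p by (auto simp: distinct_card)
    show "U b a" if "U a b" for a b using that by (auto simp: U_def)
    show "(a, b) \<in> parcs G \<or> (b, a) \<in> parcs G" if "U a b" for a b
      using that arc by (auto simp: U_def)
    show "a \<in> set xs" if "U a b" for a b
      using that nx len by (auto simp: U_def)
    show "\<exists>b c. b \<noteq> c \<and> {w. U a w} = {b, c}" if a: "a \<in> set xs" for a
    proof -
      obtain i where i: "i < l" "a = xs ! i" using a len by (auto simp: in_set_conv_nth)
      have "U a w \<longleftrightarrow> w = xs ! nx i \<or> w = xs ! pv i" for w
      proof
        assume "U a w"
        then obtain j where j: "j < l" "(a = xs ! j \<and> w = xs ! nx j) \<or> (w = xs ! j \<and> a = xs ! nx j)"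
          by (auto simp: U_def)
        then have "(i = j \<and> w = xs ! nx j) \<or> (w = xs ! j \<and> i = nx j)"
          using i nx len dist by (auto simp: nth_eq_iff_index_eq)
        then show "w = xs ! nx i \<or> w = xs ! pv i" using pvnx j by auto
      next
        assume "w = xs ! nx i \<or> w = xs ! pv i"
        moreover have "pv i < l \<and> a = xs ! nx (pv i)"
          using i pv nxpv by simp
        ultimately show "U a w"
          using i unfolding U_def by blast
      qed
      moreover have "xs ! nx i \<noteq> xs ! pv i"
        using ne nx pv i len dist by (simp add: nth_eq_iff_index_eq)
      ultimately show ?thesis by blast
    qed
    show "set xs \<subseteq> X" if a: "a \<in> X" "a \<in> set xs" and X: "\<And>x y. \<lbrakk>x \<in> X; U x y\<rbrakk> \<Longrightarrow> y \<in> X" for X a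
    proof -
      obtain i0 where i0: "i0 < l" "xs ! i0 \<in> X" using a len by (auto simp: in_set_conv_nth)
      have step: "xs ! nx i \<in> X" if "xs ! i \<in> X" "i < l" for i
        using X[OF that(1)] that(2) unfolding U_def by blast
      have up: "xs ! j \<in> X" if "i \<le> j" "j < l" "xs ! i \<in> X" for i j
        using that
      proof (induction j rule: dec_induct)
        case (step j)
        then show ?case using \<open>\<And>i. xs ! i \<in> X \<Longrightarrow> i < l \<Longrightarrow> xs ! nx i \<in> X\<close>[of j]
          by (simp add: nx_def)
      qed
      have "xs ! (l - 1) \<in> X" using up[of i0 "l - 1"] i0 by simp
      then have "xs ! 0 \<in> X" using step[of "l - 1"] i0 by (simp add: nx_def)
      then show ?thesis using up[of 0] len by (auto simp: in_set_conv_nth)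
    qed
  qed
qed

text \<open>Vertices \<open>T p\<close>, \<open>B p\<close> at position \<open>p\<close> of the top and bottom rails, which are infinite here so that
  no end effects occur; \<open>R i 0, \<dots>, R i (r i)\<close> is the \<open>i\<close>-th rung, attached at position \<open>s i\<close>.\<close>

locale subdivided_ladder =
  fixes k :: nat and s r :: "nat \<Rightarrow> nat" and T B :: "nat \<Rightarrow> 'a" and R :: "nat \<Rightarrow> nat \<Rightarrow> 'a"
  assumes T_eq: "T p = T p' \<longleftrightarrow> p = p'"
    and B_eq: "B p = B p' \<longleftrightarrow> p = p'"
    and T_neq_B: "T p \<noteq> B p'"
    and r_pos: "i < k \<Longrightarrow> 0 < r i"
    and R_eq_T: "\<lbrakk>i < k; q \<le> r i\<rbrakk> \<Longrightarrow> R i q = T p \<longleftrightarrow> q = 0 \<and> s i = p"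
    and R_eq_B: "\<lbrakk>i < k; q \<le> r i\<rbrakk> \<Longrightarrow> R i q = B p \<longleftrightarrow> q = r i \<and> s i = p"
    and R_eq_R: "\<lbrakk>i < k; q \<le> r i; j < k; q' \<le> r j\<rbrakk> \<Longrightarrow> R i q = R j q' \<longleftrightarrow> i = j \<and> q = q'"
begin

text \<open>Each edge is recorded in one direction only, along increasing positions or down a rung,
  so adjacency is \<open>edge a b \<or> edge b a\<close>.\<close>

definition edge :: "'a \<Rightarrow> 'a \<Rightarrow> bool" where
  "edge a b \<longleftrightarrow> (\<exists>p. a = T p \<and> b = T (Suc p)) \<or> (\<exists>p. a = B p \<and> b = B (Suc p)) \<or>
     (\<exists>i<k. \<exists>q<r i. a = R i q \<and> b = R i (Suc q))"

lemma B_neq_T: "B p \<noteq> T p'"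
  using T_neq_B by metis

lemma T_eq_R: "\<lbrakk>i < k; q \<le> r i\<rbrakk> \<Longrightarrow> T p = R i q \<longleftrightarrow> q = 0 \<and> s i = p"
  and B_eq_R: "\<lbrakk>i < k; q \<le> r i\<rbrakk> \<Longrightarrow> B p = R i q \<longleftrightarrow> q = r i \<and> s i = p"
  using R_eq_T R_eq_B by metis+

lemmas vertex_simps = T_eq B_eq T_neq_B B_neq_T R_eq_T R_eq_B R_eq_R T_eq_R B_eq_R

lemma R_0: "i < k \<Longrightarrow> R i 0 = T (s i)" and R_r: "i < k \<Longrightarrow> R i (r i) = B (s i)"
  by (simp_all add: vertex_simps)

lemma s_eq: "\<lbrakk>i < k; j < k; s i = s j\<rbrakk> \<Longrightarrow> i = j"
  using R_eq_R[of i 0 j 0] by (simp add: R_0)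

lemma edge_T:
  assumes "edge (T p) w \<or> edge w (T p)"
  shows "w = T (Suc p) \<or> (0 < p \<and> w = T (p - 1)) \<or> (\<exists>i<k. s i = p \<and> w = R i 1)"
  using assms by (auto simp: edge_def vertex_simps Suc_le_eq)

lemma edge_B:
  assumes "edge (B p) w \<or> edge w (B p)"
  shows "w = B (Suc p) \<or> (0 < p \<and> w = B (p - 1)) \<or> (\<exists>i<k. s i = p \<and> w = R i (r i - 1))"
  using assms by (auto simp: edge_def vertex_simps Suc_le_eq)

lemma edge_R:
  assumes "i < k" "0 < q" "q < r i" "edge (R i q) w \<or> edge w (R i q)"
  shows "w = R i (q - 1) \<or> w = R i (Suc q)"
  using assms by (auto simp: edge_def vertex_simps Suc_le_eq)

end

locale subdivided_ladder_cycle = subdivided_ladder k s r T B R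
  for k :: nat and s r :: "nat \<Rightarrow> nat" and T B :: "nat \<Rightarrow> 'a" and R :: "nat \<Rightarrow> nat \<Rightarrow> 'a" +
  fixes U :: "'a \<Rightarrow> 'a \<Rightarrow> bool" and V :: "'a set"
  \<comment> \<open>\<open>U\<close> is the edge relation and \<open>V\<close> the vertex set of a cycle.\<close>
  assumes fin: "finite V" and nonempty: "V \<noteq> {}"
    and sym: "U a b \<Longrightarrow> U b a"
    and edge: "U a b \<Longrightarrow> edge a b \<or> edge b a"
    and deg: "a \<in> V \<Longrightarrow> \<exists>b c. b \<noteq> c \<and> {w. U a w} = {b, c}"
    and in_V: "U a b \<Longrightarrow> a \<in> V"
    and conn: "\<lbrakk>a \<in> X; a \<in> V; \<And>x y. \<lbrakk>x \<in> X; U x y\<rbrakk> \<Longrightarrow> y \<in> X\<rbrakk> \<Longrightarrow> V \<subseteq> X"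
begin

section \<open>Degree conditions at rail and rung vertices\<close>

lemma deg1:
  assumes "\<And>w. U a w \<Longrightarrow> w = x"
  shows "\<not> U a x"
proof
  assume "U a x"
  from deg[OF in_V[OF this]] obtain b c where "b \<noteq> c" "{w. U a w} = {b, c}" by blast
  then have "U a b" "U a c" by blast+
  with assms \<open>b \<noteq> c\<close> show False by blast
qed

lemma deg2:
  assumes "\<And>w. U a w \<Longrightarrow> w = x \<or> w = y"
  shows "U a x \<longleftrightarrow> U a y"
  using assms deg1[of a x] deg1[of a y] by metis

text \<open>The equivalence expresses that an even number of the three edges is used, hence none or
  two.\<close>

lemma deg3:
  assumes nbr: "\<And>w. U a w \<Longrightarrow> w = x \<or> w = y \<or> w = z" and ne: "x \<noteq> y" "x \<noteq> z" "y \<noteq> z"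
  shows "(U a x \<longleftrightarrow> (U a y \<longleftrightarrow> \<not> U a z)) \<and> \<not> (U a x \<and> U a y \<and> U a z)"
proof (cases "a \<in> V")
  case True
  from deg[OF this] obtain b c where bc: "b \<noteq> c" "{w. U a w} = {b, c}" by blast
  then have "U a w \<longleftrightarrow> w = b \<or> w = c" for w by blast
  then show ?thesis using bc(1) nbr[of b] nbr[of c] ne by auto
next
  case False
  then show ?thesis using in_V by blast
qed

text \<open>\<open>used f p\<close> concerns the rail edge to the left of position \<open>p\<close>; there is none for \<open>p = 0\<close>.\<close>

definition used :: "(nat \<Rightarrow> 'a) \<Rightarrow> nat \<Rightarrow> bool" where
  "used f p \<longleftrightarrow> 0 < p \<and> U (f (p - 1)) (f p)"

text \<open>The first edge stands for the whole rung, since a cycle uses all edges of a rung or none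
  (\<open>U_R\<close>).\<close>

definition rung :: "nat \<Rightarrow> bool" where
  "rung i \<longleftrightarrow> U (R i 0) (R i 1)"

lemma U_commute: "U x y \<longleftrightarrow> U y x"
  using sym by blast

lemma used_0: "\<not> used f 0"
  by (simp add: used_def)

lemma used_Suc: "used f (Suc p) \<longleftrightarrow> U (f p) (f (Suc p))"
  by (simp add: used_def)

lemma used_sym: "used f p \<longleftrightarrow> 0 < p \<and> U (f p) (f (p - 1))"
  using U_commute by (auto simp: used_def)

text \<open>A vertex of degree 2 passes usage on; at \<open>p = 0\<close> the rail begins with a
  dead end, which no cycle visits.\<close>

lemma used_Suc_plain:
  assumes "\<And>w. U (f p) w \<Longrightarrow> w = f (Suc p) \<or> 0 < p \<and> w = f (p - 1)"
  shows "used f (Suc p) \<longleftrightarrow> used f p"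
proof (cases "p = 0")
  case True
  then show ?thesis using deg1[of "f p" "f (Suc p)"] assms by (auto simp: used_Suc used_0)
next
  case False
  then show ?thesis
    using deg2[of "f p" "f (Suc p)" "f (p - 1)"] assms by (auto simp: used_Suc used_sym[of f p])
qed

text \<open>Parity at a vertex of degree 3: it has no or exactly two used edges, hence using the rung
  toggles whether the rail is used.\<close>

lemma used_Suc_rung:
  assumes "\<And>w. U (f p) w \<Longrightarrow> w = f (Suc p) \<or> 0 < p \<and> w = f (p - 1) \<or> w = z"
    and "inj f" "\<And>p. z \<noteq> f p"
  shows "(used f (Suc p) \<longleftrightarrow> (used f p \<longleftrightarrow> \<not> U (f p) z)) \<and> \<not> (used f (Suc p) \<and> used f p \<and> U (f p) z)"
proof (cases "p = 0")
  case True
  then show ?thesis using deg2[of "f p" "f (Suc p)" z] assms(1) by (auto simp: used_Suc used_0)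
next
  case False
  then have "f (Suc p) \<noteq> f (p - 1)" using \<open>inj f\<close> by (simp add: inj_eq)
  with False show ?thesis
    using deg3[of "f p" "f (Suc p)" "f (p - 1)" z] assms(1,3) by (auto simp: used_Suc used_sym[of f p])
qed

lemma inj_T: "inj T" and inj_B: "inj B"
  by (simp_all add: inj_def vertex_simps)

text \<open>Inner rung vertices have degree 2, so usage propagates along the rung.\<close>

lemma U_R:
  assumes "i < k" "q < r i"
  shows "U (R i q) (R i (Suc q)) \<longleftrightarrow> rung i"
  using assms
proof (induction q)
  case (Suc q)
  have "U (R i (Suc q)) (R i q) \<longleftrightarrow> U (R i (Suc q)) (R i (Suc (Suc q)))"
    using edge_R[of i "Suc q"] edge Suc.prems by (intro deg2) auto
  then show ?case using Suc U_commute by auto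
qed (simp add: rung_def)

lemma used_plain:
  assumes "\<And>i. i < k \<Longrightarrow> s i \<noteq> p"
  shows "used T (Suc p) \<longleftrightarrow> used T p" "used B (Suc p) \<longleftrightarrow> used B p"
  by (rule used_Suc_plain; use edge_T edge_B edge assms in blast)+

lemma used_rung:
  assumes "i < k"
  shows "(used T (Suc (s i)) \<longleftrightarrow> (used T (s i) \<longleftrightarrow> \<not> rung i)) \<and> \<not> (used T (Suc (s i)) \<and> used T (s i) \<and> rung i)"
    and "(used B (Suc (s i)) \<longleftrightarrow> (used B (s i) \<longleftrightarrow> \<not> rung i)) \<and> \<not> (used B (Suc (s i)) \<and> used B (s i) \<and> rung i)"
proof -
  have r: "0 < r i" using r_pos assms .
  have "U (T (s i)) (R i 1) \<longleftrightarrow> rung i"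
    using assms by (simp add: rung_def R_0)
  moreover have "(used T (Suc (s i)) \<longleftrightarrow> (used T (s i) \<longleftrightarrow> \<not> U (T (s i)) (R i 1)))
      \<and> \<not> (used T (Suc (s i)) \<and> used T (s i) \<and> U (T (s i)) (R i 1))"
  proof (rule used_Suc_rung[OF _ inj_T])
    show "w = T (Suc (s i)) \<or> 0 < s i \<and> w = T (s i - 1) \<or> w = R i 1" if "U (T (s i)) w" for w
      using edge_T[OF edge[OF that]] s_eq assms by blast
    show "R i 1 \<noteq> T p" for p using r assms by (simp add: vertex_simps)
  qed
  ultimately show "(used T (Suc (s i)) \<longleftrightarrow> (used T (s i) \<longleftrightarrow> \<not> rung i)) \<and> \<not> (used T (Suc (s i)) \<and> used T (s i) \<and> rung i)"
    by blast
  \<comment> \<open>\<open>rung i\<close> is defined at the top end; \<open>U_R\<close> carries it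
    to the last edge, at the bottom rail.\<close>
  have "U (R i (r i - 1)) (R i (Suc (r i - 1))) \<longleftrightarrow> rung i"
    using U_R[of i "r i - 1"] r assms by simp
  then have "U (B (s i)) (R i (r i - 1)) \<longleftrightarrow> rung i"
    using r assms U_commute by (simp add: R_r)
  moreover have "(used B (Suc (s i)) \<longleftrightarrow> (used B (s i) \<longleftrightarrow> \<not> U (B (s i)) (R i (r i - 1))))
      \<and> \<not> (used B (Suc (s i)) \<and> used B (s i) \<and> U (B (s i)) (R i (r i - 1)))"
  proof (rule used_Suc_rung[OF _ inj_B])
    show "w = B (Suc (s i)) \<or> 0 < s i \<and> w = B (s i - 1) \<or> w = R i (r i - 1)" if "U (B (s i)) w" for w
      using edge_B[OF edge[OF that]] s_eq assms by blast
    show "R i (r i - 1) \<noteq> B p" for p using r assms R_eq_B[of i "r i - 1" p] by force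
  qed
  ultimately show "(used B (Suc (s i)) \<longleftrightarrow> (used B (s i) \<longleftrightarrow> \<not> rung i)) \<and> \<not> (used B (Suc (s i)) \<and> used B (s i) \<and> rung i)"
    by blast
qed

lemma used_B_iff_used_T: "used B p \<longleftrightarrow> used T p"
proof (induction p)
  case (Suc p)
  show ?case
  proof (cases "\<exists>i<k. s i = p")
    case True
    then show ?thesis using used_rung Suc.IH by blast
  next
    case False
    then show ?thesis using used_plain[of p] Suc.IH by blast
  qed
qed (simp add: used_def)

section \<open>Extent and length of a cycle\<close>

text \<open>Some edge is used. If it lies on a rung, the whole rung is used, and parity at its top
  end forces a rail edge.\<close>

lemma ex_used: "\<exists>p. used T p"
proof -
  obtain v where "v \<in> V" using nonempty by blast
  then obtain w where "U v w" using deg by blast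
  then have "edge v w \<and> U v w \<or> edge w v \<and> U w v" using edge sym by blast
  then obtain x y where xy: "edge x y" "U x y" by blast
  from xy(1) consider p where "x = T p" "y = T (Suc p)" | p where "x = B p" "y = B (Suc p)"
    | i q where "i < k" "q < r i" "x = R i q" "y = R i (Suc q)"
    unfolding edge_def by blast
  then show ?thesis
  proof cases
    case 3
    then have "rung i" using U_R xy(2) by blast
    then show ?thesis using used_rung[of i] \<open>i < k\<close> by blast
  qed (use xy(2) used_B_iff_used_T used_Suc in blast)+
qed

lemma used_in_V:
  assumes "used T p"
  shows "T p \<in> V" "T (p - 1) \<in> V" "B p \<in> V" "B (p - 1) \<in> V"
  using assms used_B_iff_used_T[of p] in_V sym unfolding used_def by blast+

lemma ex_unused: "\<exists>p>a. \<not> used T p"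
proof (rule ccontr)
  assume "\<not> ?thesis"
  then have "T ` {a<..} \<subseteq> V" using used_in_V by auto
  then have "finite (T ` {a<..})" using fin finite_subset by blast
  then have "finite {a<..}" using inj_T by (simp add: finite_image_iff inj_on_subset)
  then show False using infinite_Ioi by blast
qed

lemma used_interval:
  obtains a c where "a < c" "\<not> used T a" "\<not> used T (Suc c)" "\<And>p. a < p \<Longrightarrow> p \<le> c \<Longrightarrow> used T p"
proof -
  define a' where "a' = (LEAST p. used T p)"
  have a': "used T a'" "\<And>p. p < a' \<Longrightarrow> \<not> used T p"
    unfolding a'_def using ex_used by (metis LeastI, metis not_less_Least)
  then have "0 < a'" by (simp add: used_def)
  define c' where "c' = (LEAST p. a' < p \<and> \<not> used T p)"
  have c': "a' < c'" "\<not> used T c'" "\<And>p. a' < p \<Longrightarrow> p < c' \<Longrightarrow> used T p"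
    unfolding c'_def using LeastI_ex[OF ex_unused[of a']] by (blast, blast, metis not_less_Least)
  show ?thesis
  proof (rule that[of "a' - 1" "c' - 1"])
    fix p assume "a' - 1 < p" "p \<le> c' - 1"
    then show "used T p" using a'(1) c'(1,3) by (cases "p = a'") auto
  qed (use \<open>0 < a'\<close> a' c' in auto)
qed

text \<open>Used rungs must sit at both ends of the run, and none in between, where a rail vertex
  already has two used edges. These two rungs and the rail stretches between them close up to a
  cycle.\<close>

lemma cycle_size: "\<exists>i<k. \<exists>j<k. s i < s j \<and> card V + 2 * s i = r i + r j + 2 * s j"
proof -
  obtain a c where ac: "a < c" "\<not> used T a" "\<not> used T (Suc c)" "\<And>p. a < p \<Longrightarrow> p \<le> c \<Longrightarrow> used T p"
    using used_interval by metis
  have "used T (Suc a)" "used T c" using ac by auto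
  \<comment> \<open>Usage changes at position \<open>a\<close>, which only a used rung there can
    cause; likewise at \<open>c\<close> below.\<close>
  obtain i where i: "i < k" "s i = a" "rung i"
    using used_plain[of a] used_rung \<open>used T (Suc a)\<close> ac(2) by blast
  obtain j where j: "j < k" "s j = c" "rung j"
    using used_plain[of c] used_rung \<open>used T c\<close> ac(3) by blast
  have no_rung: "m = i \<or> m = j" if "m < k" "a \<le> s m" "s m \<le> c" "rung m" for m
  proof (rule ccontr)
    assume "\<not> ?thesis"
    then have "s m \<noteq> a" "s m \<noteq> c" using s_eq i j that by blast+
    then have "used T (s m)" "used T (Suc (s m))" using ac(4) that by auto
    then show False using used_rung[of m] that by blast
  qed
  \<comment> \<open>The cycle between rungs \<open>i\<close> and \<open>j\<close>: no used edge leaves it, so by connectedness it is all of \<open>V\<close>.\<close>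
  define X where "X = T ` {a..c} \<union> B ` {a..c} \<union> R i ` {0<..<r i} \<union> R j ` {0<..<r j}"
  have TX: "T p \<in> X" and BX: "B p \<in> X" if "a \<le> p" "p \<le> c" for p
    using that by (auto simp: X_def)
  have RX: "R m q \<in> X" if "m = i \<or> m = j" "q \<le> r m" for m q
  proof -
    have m: "m < k" "a \<le> s m" "s m \<le> c" using that i j ac(1) by auto
    show ?thesis
    proof (cases "q = 0 \<or> q = r m")
      case True
      then show ?thesis using m TX BX R_0 R_r by auto
    next
      case False
      then have "q \<in> {0<..<r m}" using that(2) by simp
      then show ?thesis using that(1) by (auto simp: X_def)
    qed
  qed
  have "X \<subseteq> V"
  proof -
    have "T p \<in> V \<and> B p \<in> V" if "a \<le> p" "p \<le> c" for p
      using used_in_V[of p] used_in_V[of "Suc p"] ac(1,4) that by (cases "p = a") auto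
    moreover have "R m q \<in> V" if "m < k" "rung m" "q < r m" for m q
      using U_R[OF that(1,3)] that(2) in_V by blast
    ultimately show ?thesis using i j unfolding X_def by auto
  qed
  moreover have "V \<subseteq> X"
  proof (rule conn[of "T a"])
    show "T a \<in> X" using TX ac(1) by simp
    then show "T a \<in> V" using \<open>X \<subseteq> V\<close> by blast
    fix x y assume "x \<in> X" "U x y"
    then have e: "edge x y \<or> edge y x" using edge by blast
    consider "x \<in> T ` {a..c}" | "x \<in> B ` {a..c}" | m where "m = i \<or> m = j" "x \<in> R m ` {0<..<r m}"
      using \<open>x \<in> X\<close> unfolding X_def by blast
    then show "y \<in> X"
    proof cases
      case 1
      then obtain p where p: "a \<le> p" "p \<le> c" "x = T p" by auto
      from edge_T[OF e[unfolded p(3)]]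
      consider "y = T (Suc p)" | "0 < p" "y = T (p - 1)" | m where "m < k" "s m = p" "y = R m 1" by blast
      then show ?thesis
      proof cases
        case 1
        then have "used T (Suc p)" using \<open>U x y\<close> \<open>x = T p\<close> by (simp add: used_Suc)
        then have "p \<noteq> c" using ac(3) by blast
        then show ?thesis using 1 TX \<open>a \<le> p\<close> \<open>p \<le> c\<close> by simp
      next
        case 2
        then have "used T p" using \<open>U x y\<close> \<open>x = T p\<close> by (simp add: used_sym)
        then have "p \<noteq> a" using ac(2) by blast
        then show ?thesis using 2 TX \<open>a \<le> p\<close> \<open>p \<le> c\<close> by simp
      next
        case 3
        then have "rung m" using \<open>U x y\<close> \<open>x = T p\<close> R_0 by (auto simp: rung_def)
        then have "m = i \<or> m = j" using no_rung 3 \<open>a \<le> p\<close> \<open>p \<le> c\<close> by blast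
        then show ?thesis using RX[of m 1] r_pos 3 by (simp add: Suc_le_eq)
      qed
    next
      case 2
      then obtain p where p: "a \<le> p" "p \<le> c" "x = B p" by auto
      from edge_B[OF e[unfolded p(3)]]
      consider "y = B (Suc p)" | "0 < p" "y = B (p - 1)" | m where "m < k" "s m = p" "y = R m (r m - 1)" by blast
      then show ?thesis
      proof cases
        case 1
        then have "used T (Suc p)"
          using \<open>U x y\<close> \<open>x = B p\<close> used_B_iff_used_T[of "Suc p"] by (simp add: used_Suc)
        then have "p \<noteq> c" using ac(3) by blast
        then show ?thesis using 1 BX \<open>a \<le> p\<close> \<open>p \<le> c\<close> by simp
      next
        case 2
        then have "used T p"
          using \<open>U x y\<close> \<open>x = B p\<close> used_B_iff_used_T[of p] by (simp add: used_sym)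
        then have "p \<noteq> a" using ac(2) by blast
        then show ?thesis using 2 BX \<open>a \<le> p\<close> \<open>p \<le> c\<close> by simp
      next
        case 3
        then have "U (R m (r m - 1)) (R m (Suc (r m - 1)))"
          using \<open>U x y\<close> \<open>x = B p\<close> R_r r_pos sym by fastforce
        then have "rung m" using U_R[of m "r m - 1"] r_pos 3 by simp
        then have "m = i \<or> m = j" using no_rung 3 \<open>a \<le> p\<close> \<open>p \<le> c\<close> by blast
        then show ?thesis using RX[of m "r m - 1"] 3 by simp
      qed
    next
      case 3
      then obtain q where q: "0 < q" "q < r m" "x = R m q" by auto
      have "m < k" using 3 i j by blast
      then have "y = R m (q - 1) \<or> y = R m (Suc q)" using edge_R e q by blast
      then show ?thesis using RX[of m] 3 q by auto
    qed
  qed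
  ultimately have "V = X" by blast
  have "i \<noteq> j" using i j ac(1) by auto
  have "inj_on (R m) {0<..<r m}" if "m < k" for m
    using that by (auto simp: inj_on_def vertex_simps)
  then have R: "card (R m ` {0<..<r m}) = r m - 1" if "m < k" for m
    using that by (simp add: card_image)
  have "card (T ` {a..c}) = Suc c - a" "card (B ` {a..c}) = Suc c - a"
    using inj_T inj_B by (simp_all add: card_image inj_on_subset)
  moreover have "T ` {a..c} \<inter> B ` {a..c} = {}" by (auto simp: vertex_simps)
  moreover have "(T ` {a..c} \<union> B ` {a..c}) \<inter> R i ` {0<..<r i} = {}"
    using i by (auto simp: vertex_simps)
  moreover have "(T ` {a..c} \<union> B ` {a..c} \<union> R i ` {0<..<r i}) \<inter> R j ` {0<..<r j} = {}"
    using i j \<open>i \<noteq> j\<close> by (auto simp: vertex_simps)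
  \<comment> \<open>Each rail stretch has \<open>c - a + 1\<close> vertices; rungs count only inner
    vertices, as their ends lie on the rails.\<close>
  ultimately have "card X = (Suc c - a) + (Suc c - a) + (r i - 1) + (r j - 1)"
    unfolding X_def using R i j by (simp add: card_Un_disjoint)
  then have "card V + 2 * s i = r i + r j + 2 * s j"
    using \<open>V = X\<close> r_pos[of i] r_pos[of j] i j ac(1) by simp
  then show ?thesis using i j ac(1) by blast
qed

end

text \<open>A cycle of \<open>G\<close> is also one of the graph with infinite rails, so a graph
  with finite rails qualifies.\<close>

lemma (in subdivided_ladder) cycle_spectrum_subset:
  assumes "\<And>a b. (a, b) \<in> parcs G \<Longrightarrow> edge a b \<or> edge b a" "l \<in> cycle_spectrum G"
  shows "\<exists>i<k. \<exists>j<k. s i < s j \<and> l + 2 * s i = r i + r j + 2 * s j"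
proof (rule cycle_spectrum_used_edges[OF assms(2)])
  fix U V
  assume UV: "finite V" "V \<noteq> {}" "card V = l"
    "\<And>a b. U a b \<Longrightarrow> U b a"
    "\<And>a b. U a b \<Longrightarrow> (a, b) \<in> parcs G \<or> (b, a) \<in> parcs G"
    "\<And>a. a \<in> V \<Longrightarrow> \<exists>b c. b \<noteq> c \<and> {w. U a w} = {b, c}"
    "\<And>a b. U a b \<Longrightarrow> a \<in> V"
    "\<And>X a. \<lbrakk>a \<in> X; a \<in> V; \<And>x y. \<lbrakk>x \<in> X; U x y\<rbrakk> \<Longrightarrow> y \<in> X\<rbrakk> \<Longrightarrow> V \<subseteq> X"
  interpret subdivided_ladder_cycle k s r T B R U V
  proof
    show "edge a b \<or> edge b a" if "U a b" for a b
      using UV(5)[OF that] assms(1) by blast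
  qed (fact UV)+
  show ?thesis using cycle_size UV(3) by simp
qed

section \<open>Subdivisions of the ladder with prescribed lengths\<close>

lemma vwalk_arcs_neq: "\<lbrakk>distinct p; (a, b) \<in> set (vwalk_arcs p)\<rbrakk> \<Longrightarrow> a \<noteq> b"
  by (induction p rule: vwalk_arcs.induct) auto

lemma set_vwalk_arcs_map_upt:
  "set (vwalk_arcs (map f [m..<n])) = {(f i, f (Suc i)) |i. m \<le> i \<and> Suc i < n}"
proof (induction n)
  case (Suc n)
  show ?case
  proof (cases "m < n")
    case True
    then have "[m..<n] \<noteq> []" "last [m..<n] = n - 1" by (auto simp: last_conv_nth)
    then have "set (vwalk_arcs (map f [m..<Suc n]))
        = insert (f (n - 1), f n) {(f i, f (Suc i)) |i. m \<le> i \<and> Suc i < n}"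
      using True Suc.IH set_vwalk_arcs_snoc[of "map f [m..<n]" "f n"] by (simp add: last_map)
    also have "\<dots> = {(f i, f (Suc i)) |i. m \<le> i \<and> Suc i < Suc n}"
      using True by (force simp: less_Suc_eq)
    finally show ?thesis .
  next
    case False
    then show ?thesis by (cases "m = n") auto
  qed
qed simp

lemma interior_verts_rev: "interior_verts (rev p) = interior_verts p"
  unfolding interior_verts_def by (metis butlast_rev butlast_tl rev_rev_ident set_rev)

lemma interior_verts_map_upt: "m < n \<Longrightarrow> interior_verts (map f [m..<Suc n]) = f ` {m<..<n}"
proof -
  assume "m < n"
  then have "[m..<Suc n] = m # [Suc m..<n] @ [n]" by (simp add: upt_conv_Cons)
  then show ?thesis by (auto simp: interior_verts_def butlast_append)
qed

text \<open>\<open>D\<close> is an orientation of \<open>H\<close>; only its arcs need to be assigned a path.\<close>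

lemma subdivision_of_paths:
  fixes D :: "('a \<times> 'a) set" and P :: "'a \<Rightarrow> 'a \<Rightarrow> 'a list"
  defines "A \<equiv> \<Union>(u, v)\<in>D. set (vwalk_arcs (P u v))"
  assumes "finite (pverts H)" and "finite D" and parcs: "parcs H = D \<union> D\<inverse>"
    and asym: "\<And>u v. (u, v) \<in> D \<Longrightarrow> (v, u) \<notin> D"
    and path: "\<And>u v. (u, v) \<in> D \<Longrightarrow> distinct (P u v) \<and> 2 \<le> length (P u v) \<and>
      hd (P u v) = u \<and> last (P u v) = v \<and> interior_verts (P u v) \<inter> pverts H = {}"
    and disj: "\<And>u v x y. \<lbrakk>(u, v) \<in> D; (x, y) \<in> D; (u, v) \<noteq> (x, y)\<rbrakk> \<Longrightarrow>
      interior_verts (P u v) \<inter> interior_verts (P x y) = {}"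
  shows "subdivision_of
    \<lparr> pverts = pverts H \<union> (\<Union>(u, v)\<in>D. set (P u v)), parcs = A \<union> A\<inverse> \<rparr> H"
    (is "subdivision_of ?G H")
proof -
  \<comment> \<open>Arcs outside \<open>D\<close> get the reversed path of the opposite arc, as
    \<open>subdivision_of\<close> demands.\<close>
  define P' where "P' u v = (if (u, v) \<in> D then P u v else rev (P v u))" for u v
  have P'_D: "P' u v = P u v" "P' v u = rev (P u v)" if "(u, v) \<in> D" for u v
    using that asym by (auto simp: P'_def)
  define W where "W = pverts H \<union> (\<Union>(u, v)\<in>D. set (P u v))"
  have A: "A \<subseteq> W \<times> W"
    unfolding A_def W_def using arcs_in_vwalk_arcs by fastforce
  have "finite W" using assms by (auto simp: W_def)
  moreover have "finite (parcs ?G)" using \<open>finite D\<close> by (auto simp: A_def)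
  moreover have "fst e \<noteq> snd e" if "e \<in> parcs ?G" for e
    using that path vwalk_arcs_neq by (fastforce simp: A_def)
  moreover have "symmetric ?G" by (auto simp: symmetric_def sym_def)
  ultimately have G: "pair_graph ?G"
    unfolding W_def[symmetric] using A by unfold_locales auto
  have oriented: "\<exists>x y. (x, y) \<in> D \<and> {u, v} = {x, y} \<and> interior_verts (P' u v) = interior_verts (P x y)"
    if "(u, v) \<in> parcs H" for u v
    using that P'_D unfolding parcs by (fastforce simp: interior_verts_rev doubleton_eq_iff)
  show ?thesis
    unfolding subdivision_of_def
  proof (intro conjI exI[of _ P'] G)
    have vpath: "vpath p (with_proj ?G)" if "p = P u v \<or> p = rev (P u v)" "(u, v) \<in> D" for p u v
    proof -
      have "set p = set (P u v)" "distinct p" "p \<noteq> []" using that path by fastforce+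
      moreover have "set (vwalk_arcs p) \<subseteq> A \<union> A\<inverse>"
        using that set_vwalk_arcs_rev unfolding A_def by fastforce
      ultimately show ?thesis using that by (auto simp: vpath_def vwalk_def)
    qed
    show "\<forall>(u, v)\<in>parcs H. vpath (P' u v) (with_proj ?G) \<and> 1 \<le> vwalk_length (P' u v) \<and>
        hd (P' u v) = u \<and> last (P' u v) = v \<and> P' v u = rev (P' u v) \<and>
        interior_verts (P' u v) \<inter> pverts H = {}"
    proof clarify
      fix u v assume "(u, v) \<in> parcs H"
      then consider "(u, v) \<in> D" | "(v, u) \<in> D" unfolding parcs by blast
      then show "vpath (P' u v) (with_proj ?G) \<and> 1 \<le> vwalk_length (P' u v) \<and>
          hd (P' u v) = u \<and> last (P' u v) = v \<and> P' v u = rev (P' u v) \<and>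
          interior_verts (P' u v) \<inter> pverts H = {}"
      proof cases
        case 1
        show ?thesis using path[OF 1] vpath[OF _ 1, of "P u v"] by (auto simp: P'_D[OF 1])
      next
        case 2
        show ?thesis using path[OF 2] vpath[OF _ 2, of "rev (P v u)"]
          by (auto simp: P'_D[OF 2] interior_verts_rev hd_rev last_rev)
      qed
    qed
    show "\<forall>(u, v)\<in>parcs H. \<forall>(x, y)\<in>parcs H. {u, v} \<noteq> {x, y} \<longrightarrow>
        interior_verts (P' u v) \<inter> interior_verts (P' x y) = {}"
    proof clarify
      fix u v x y assume "(u, v) \<in> parcs H" "(x, y) \<in> parcs H" "{u, v} \<noteq> {x, y}"
      then show "interior_verts (P' u v) \<inter> interior_verts (P' x y) = {}"
        using oriented[of u v] oriented[of x y] disj by (metis prod.inject)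
    qed
    show "pverts ?G = pverts H \<union> (\<Union>(u, v)\<in>parcs H. set (P' u v))"
      using P'_D unfolding parcs by fastforce
    show "parcs ?G = (\<Union>(u, v)\<in>parcs H. set (vwalk_arcs (P' u v)))"
    proof -
      have "(\<Union>(u, v)\<in>D. set (vwalk_arcs (P' u v))) = A"
        unfolding A_def using P'_D(1) by (intro SUP_cong) auto
      moreover have "(\<Union>(u, v)\<in>D. set (vwalk_arcs (P' v u))) = (\<Union>(u, v)\<in>D. (set (vwalk_arcs (P u v)))\<inverse>)"
        using P'_D(2) by (intro SUP_cong) (auto simp: set_vwalk_arcs_rev)
      moreover have "\<dots> = A\<inverse>"
        by (auto simp: A_def)
      moreover have "(\<Union>(u, v)\<in>parcs H. X u v) = (\<Union>(u, v)\<in>D. X u v) \<union> (\<Union>(u, v)\<in>D. X v u)"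
        for X :: "'a \<Rightarrow> 'a \<Rightarrow> ('a \<times> 'a) set"
        unfolding parcs by auto
      ultimately show ?thesis by simp
    qed
  qed
qed

text \<open>Rung \<open>i\<close> is attached at position \<open>s i\<close>, so the rail edges to
  the next rung become paths of length \<open>s (Suc i) - s i\<close>, which is positive by
  monotonicity.\<close>

lemma ladder_subdivision:
  fixes s r :: "nat \<Rightarrow> nat"
  assumes s: "strict_mono_on {..<k} s" and r: "\<And>i. i < k \<Longrightarrow> 0 < r i"
  obtains G where "subdivision_of G (ladder k)"
    "\<And>l. l \<in> cycle_spectrum G \<Longrightarrow> \<exists>i<k. \<exists>j<k. s i < s j \<and> l + 2 * s i = r i + r j + 2 * s j"
proof -
  have inj: "inj_on s {..<k}" using s by (rule strict_mono_on_imp_inj_on)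
  \<comment> \<open>A position carrying a rung gets the ladder vertex itself, any other a new vertex
    with first coordinate 2 or 3.\<close>
  define rail :: "nat \<Rightarrow> nat \<Rightarrow> nat \<times> nat" where
    "rail a p = (if p \<in> s ` {..<k} then (a, inv_into {..<k} s p) else (a + 2, p))" for a p
  have rail_s: "rail a (s i) = (a, i)" if "i < k" for a i
    using that inj by (simp add: rail_def)
  have rail_eq: "rail a p = rail a' p' \<longleftrightarrow> a = a' \<and> p = p'" if "a < 2" "a' < 2" for a a' p p'
    using that inj by (auto simp: rail_def)
  \<comment> \<open>First coordinates from 4 on keep inner rung vertices apart from all rail
    vertices.\<close>
  define R where "R i q = (if q = 0 then (0, i) else if q = r i then (1, i) else (i + 4, q))" for i q
  interpret subdivided_ladder k s r "rail 0" "rail 1" R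
  proof
    fix i q p assume "i < k" "q \<le> r i"
    then show "R i q = rail 0 p \<longleftrightarrow> q = 0 \<and> s i = p" "R i q = rail 1 p \<longleftrightarrow> q = r i \<and> s i = p"
      using r[of i] by (auto simp: R_def rail_def inj inj_on_eq_iff[OF inj])
  next
    fix i q j q' assume "i < k" "q \<le> r i" "j < k" "q' \<le> r j"
    then show "R i q = R j q' \<longleftrightarrow> i = j \<and> q = q'"
      using r by (auto simp: R_def)
  qed (use r in \<open>auto simp: rail_eq\<close>)
  define D where "D = {((a, i), (a, Suc i)) |a i. a < (2::nat) \<and> Suc i < k} \<union> {((0, i), (1, i)) |i. i < k}"
  define P where "P u v = (if fst u = fst v then map (rail (fst u)) [s (snd u)..<Suc (s (snd v))]
    else map (R (snd u)) [0..<Suc (r (snd u))])" for u v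
  have s_Suc: "s i < s (Suc i)" if "Suc i < k" for i
    using s that by (auto simp: strict_mono_on_def)
  have gap: "p \<notin> s ` {..<k}" if "s i < p" "p < s (Suc i)" "Suc i < k" for i p
  proof
    assume "p \<in> s ` {..<k}"
    then obtain j where "j < k" "p = s j" by blast
    with that have "i < j" "j < Suc i"
      using strict_mono_on_less[OF s] by auto
    then show False by simp
  qed
  have int_rail: "interior_verts (P (a, i) (a, Suc i)) = {a + 2} \<times> {s i<..<s (Suc i)}" if "Suc i < k" for a i
    using gap[OF _ _ that] s_Suc[OF that]
    by (force simp: P_def interior_verts_map_upt rail_def simp del: upt_Suc)
  have int_rung: "interior_verts (P (0, i) (1, i)) = {i + 4} \<times> {0<..<r i}" if "i < k" for i
    using r[OF that] by (force simp: P_def interior_verts_map_upt R_def simp del: upt_Suc)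
  let ?A = "\<Union>(u, v)\<in>D. set (vwalk_arcs (P u v))"
  let ?G = "\<lparr> pverts = pverts (ladder k) \<union> (\<Union>(u, v)\<in>D. set (P u v)), parcs = ?A \<union> ?A\<inverse> \<rparr>"
  have pverts: "pverts (ladder k) = {..<2} \<times> {..<k}"
    by (auto simp: ladder_def cartesian_product_def complete_graph_2_def path_graph_def)
  have parcs: "parcs (ladder k) = D \<union> D\<inverse>"
    by (auto simp: D_def less_2_cases_iff ladder_def cartesian_product_def complete_graph_2_def path_graph_def)
  have "subdivision_of ?G (ladder k)"
  proof (rule subdivision_of_paths)
    show "finite (pverts (ladder k))" by (simp add: pverts)
    show "finite D"
      by (rule finite_subset[of _ "({..<2} \<times> {..<k}) \<times> ({..<2} \<times> {..<k})"]) (auto simp: D_def)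
    show "(v, u) \<notin> D" if "(u, v) \<in> D" for u v using that by (auto simp: D_def)
    show "distinct (P u v) \<and> 2 \<le> length (P u v) \<and> hd (P u v) = u \<and> last (P u v) = v \<and>
        interior_verts (P u v) \<inter> pverts (ladder k) = {}" if "(u, v) \<in> D" for u v
    proof -
      consider a i where "u = (a, i)" "v = (a, Suc i)" "a < 2" "Suc i < k" | i where "u = (0, i)" "v = (1, i)" "i < k"
        using \<open>(u, v) \<in> D\<close> by (auto simp: D_def)
      then show ?thesis
      proof cases
        case 1
        have "distinct (P u v)"
          using 1 by (auto simp: P_def distinct_map inj_on_def rail_eq simp del: upt_Suc)
        moreover have "2 \<le> length (P u v)" "hd (P u v) = u" "last (P u v) = v"
          using 1 s_Suc[of i] by (auto simp: P_def rail_s hd_map last_map simp del: upt_Suc)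
        moreover have "interior_verts (P u v) \<inter> pverts (ladder k) = {}"
          using 1 int_rail by (auto simp: pverts)
        ultimately show ?thesis by blast
      next
        case 2
        have "distinct (P u v)"
          using 2 R_eq_R by (auto simp: P_def distinct_map inj_on_def simp del: upt_Suc)
        moreover have "2 \<le> length (P u v)" "hd (P u v) = u" "last (P u v) = v"
          using 2 r[of i] by (auto simp: P_def R_def hd_map last_map simp del: upt_Suc)
        moreover have "interior_verts (P u v) \<inter> pverts (ladder k) = {}"
          using 2 int_rung by (auto simp: pverts)
        ultimately show ?thesis by blast
      qed
    qed
    have disjoint_gaps: False if "i < j" "Suc j < k" "p < s (Suc i)" "s j < p" for i j p
      using strict_mono_on_leD[OF s, of "Suc i" j] that by simp
    show "interior_verts (P u v) \<inter> interior_verts (P x y) = {}"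
      if uv: "(u, v) \<in> D" and xy: "(x, y) \<in> D" and ne: "(u, v) \<noteq> (x, y)" for u v x y
    proof -
      have cases: "(\<exists>a i. w = (a, i) \<and> w' = (a, Suc i) \<and> a < 2 \<and> Suc i < k
            \<and> interior_verts (P w w') = {a + 2} \<times> {s i<..<s (Suc i)})
          \<or> (\<exists>i. w = (0, i) \<and> w' = (1, i) \<and> interior_verts (P w w') = {i + 4} \<times> {0<..<r i})"
        if "(w, w') \<in> D" for w w'
        using that int_rail int_rung unfolding D_def by fastforce
      show ?thesis
        using cases[OF uv] cases[OF xy]
      proof (elim disjE exE conjE)
        fix a i a' i'
        assume *: "u = (a, i)" "v = (a, Suc i)" "x = (a', i')" "y = (a', Suc i')"
          "Suc i < k" "Suc i' < k"
          "interior_verts (P u v) = {a + 2} \<times> {s i<..<s (Suc i)}"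
          "interior_verts (P x y) = {a' + 2} \<times> {s i'<..<s (Suc i')}"
        then have "a \<noteq> a' \<or> i < i' \<or> i' < i" using ne by auto
        then show ?thesis using disjoint_gaps[of i i'] disjoint_gaps[of i' i] * by force
      qed (use ne in auto)
    qed
  qed (rule parcs)
  \<comment> \<open>Only an inclusion: the rails of the locale continue beyond the outermost rungs,
    where \<open>?G\<close> has no arcs.\<close>
  moreover have "edge a b \<or> edge b a" if "(a, b) \<in> parcs ?G" for a b
  proof -
    have rail_edge: "edge (rail a p) (rail a (Suc p))" if "a < 2" for a p
      using less_2_cases[OF that] unfolding edge_def by auto
    have rung_edge: "edge (R i q) (R i (Suc q))" if "i < k" "q < r i" for i q
      using that unfolding edge_def by blast
    have "edge x y" if "(x, y) \<in> ?A" for x y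
    proof -
      obtain u v where "(u, v) \<in> D" "(x, y) \<in> set (vwalk_arcs (P u v))" using \<open>(x, y) \<in> ?A\<close> by blast
      then show ?thesis
        by (auto simp: D_def P_def set_vwalk_arcs_map_upt rail_edge rung_edge simp del: upt_Suc One_nat_def)
    qed
    moreover have "(a, b) \<in> ?A \<or> (b, a) \<in> ?A" using that by simp
    ultimately show ?thesis by blast
  qed
  ultimately show ?thesis
    using that[of ?G] cycle_spectrum_subset[of ?G] by blast
qed

section \<open>Turning pairs into positions and lengths of rungs\<close>

theorem theorem1p5:
  fixes n :: nat and \<alpha> :: real
  assumes "\<alpha> > ln 2 / ln (1 + sqrt 2)"
  shows "\<exists>k\<ge>n. \<exists>G. subdivision_of G (ladder k) \<and>
           real (card (cycle_spectrum G)) \<le> real k powr \<alpha>"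
proof -
  obtain Z :: "int list set" and x y :: "int list \<Rightarrow> nat" where "finite Z" "n \<le> card Z"
    and inj: "inj_on (\<lambda>z. int (x z) - int (y z)) Z"
    and card_sums: "card {x z + y z' |z z'. z \<in> Z \<and> z' \<in> Z} \<le> real (card Z) powr \<alpha>"
    and finite_sums: "finite {x z + y z' |z z'. z \<in> Z \<and> z' \<in> Z}"
    by (rule many_differences_few_sums[OF assms, of n]) (rule that)
  \<comment> \<open>The shift \<open>K\<close> dominates every \<open>y z\<close>, so the
    subtraction in \<open>d\<close> never truncates.\<close>
  define K where "K = sum y Z"
  have K: "y z \<le> K" if "z \<in> Z" for z
    unfolding K_def using \<open>finite Z\<close> that by (intro member_le_sum) auto
  define d where "d z = x z + K - y z" for z
  have d: "d z + y z = x z + K" if "z \<in> Z" for z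
    using K[OF that] by (simp add: d_def)
  have "inj_on d Z"
  proof (rule inj_onI)
    fix z z' assume "z \<in> Z" "z' \<in> Z" "d z = d z'"
    then have "int (x z) - int (y z) = int (x z') - int (y z')"
      using d[of z] d[of z'] by linarith
    then show "z = z'" using inj \<open>z \<in> Z\<close> \<open>z' \<in> Z\<close> by (auto dest: inj_onD)
  qed
  then have card_d: "card (d ` Z) = card Z" by (rule card_image)
  \<comment> \<open>Sorts the positions, as the ladder needs increasing ones; \<open>z i\<close> is
    then the vector behind rung \<open>i\<close>.\<close>
  obtain s where s: "bij_betw s {..<card Z} (d ` Z)" "strict_mono_on {..<card Z} s"
    using ex_bij_betw_strict_mono_card[of "d ` Z"] \<open>finite Z\<close> card_d by auto
  define z where "z i = inv_into Z d (s i)" for i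
  have z: "z i \<in> Z" "s i + y (z i) = x (z i) + K" if "i < card Z" for i
  proof -
    have "s i \<in> d ` Z" using s(1) that by (auto simp: bij_betw_def)
    then show "z i \<in> Z" "s i + y (z i) = x (z i) + K"
      using d[of "z i"] by (auto simp: z_def inv_into_into f_inv_into_f)
  qed
  \<comment> \<open>With these rung lengths the length of the cycle through rungs \<open>i < j\<close> no longer involves
    \<open>y (z j)\<close> and \<open>x (z i)\<close>.\<close>
  obtain G where G: "subdivision_of G (ladder (card Z))"
    and cycles: "\<And>l. l \<in> cycle_spectrum G \<Longrightarrow> \<exists>i<card Z. \<exists>j<card Z. s i < s j \<and>
      l + 2 * s i = (2 * (x (z i) + y (z i)) + 1) + (2 * (x (z j) + y (z j)) + 1) + 2 * s j"
    using ladder_subdivision[OF s(2), of "\<lambda>i. 2 * (x (z i) + y (z i)) + 1"] by auto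
  let ?S = "{x z + y z' |z z'. z \<in> Z \<and> z' \<in> Z}"
  have "cycle_spectrum G \<subseteq> (\<lambda>v. 4 * v + 2) ` ?S"
  proof
    fix l assume "l \<in> cycle_spectrum G"
    then obtain i j where ij: "i < card Z" "j < card Z"
      "l + 2 * s i = (2 * (x (z i) + y (z i)) + 1) + (2 * (x (z j) + y (z j)) + 1) + 2 * s j"
      using cycles by blast
    \<comment> \<open>\<open>K\<close> cancels; the final 2 comes from the two summands 1 that keep
      the rung lengths positive.\<close>
    then have "l = 4 * (x (z j) + y (z i)) + 2"
      using z(2)[OF ij(1)] z(2)[OF ij(2)] by simp
    then show "l \<in> (\<lambda>v. 4 * v + 2) ` ?S" using z(1) ij by blast
  qed
  then have "card (cycle_spectrum G) \<le> card ?S"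
    using finite_sums by (metis (no_types, lifting) card_image_le card_mono finite_imageI le_trans)
  then have "real (card (cycle_spectrum G)) \<le> real (card Z) powr \<alpha>"
    using card_sums by linarith
  then show ?thesis using G \<open>n \<le> card Z\<close> by blast
qed

end
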